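(* Let $(R,S)$ be a Rota-Baxter system on a Hom-associative algebra $(A,\alpha,\mu)$. Then the linear map $T:A^{\otimes 2}\to A^{\otimes 2}$ defined by $$T(a\otimes b)=R(a)\otimes b+a\otimes S(b)$$ is a weak pseudotwistor.
   Context: All vector spaces, linear maps and tensor products are over a field $\mathbb{K}$. A (multiplicative) Hom-associative algebra $(A,\alpha,\mu)$ is a vector space $A$ with a linear map $\alpha:A\to A$ and a bilinear map $\mu:A\otimes A\to A$, $a\otimes b\mapsto a\cdot b$, such that $(a\cdot b)\cdot\alpha(c)=\alpha(a)\cdot(b\cdot c)$ and $\alpha(a\cdot b)=\alpha(a)\cdot\alpha(b)$ for all $a,b,c\in A$. All Hom-associative algebras are assumed multiplicative. A Rota-Baxter system on $(A,\alpha,\mu)$ is a pair $(R,S)$ of linear maps $A\to A$ with $\alpha\circ R=R\circ\alpha$, $\alpha\circ S=S\circ\alpha$ and, for all $a,b\in A$, $$R(a)\cdot R(b)=R(R(a)\cdot b+a\cdot S(b)),\qquad S(a)\cdot S(b)=S(R(a)\cdot b+a\cdot S(b)).$$ A linear map $T:A^{\otimes 2}\to A^{\otimes 2}$ is a weak pseudotwistor on $(A,\alpha,\mu)$ if $\alpha^{\otimes 2}\circ T=T\circ\alpha^{\otimes 2}$ and there exists a linear map $\tau:A^{\otimes 3}\to A^{\otimes 3}$ (a weak companion of $T$) with $\alpha^{\otimes 3}\circ\tau=\tau\circ\alpha^{\otimes 3}$ such that $$T\circ(\alpha\otimes\mu)\circ(\mathrm{id}\otimes T)=(\alpha\otimes\mu)\circ\tau,\qquad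 T\circ(\mu\otimes\alpha)\circ(T\otimes\mathrm{id})=(\mu\otimes\alpha)\circ\tau$$ as maps $A^{\otimes 3}\to A^{\otimes 2}$. *)

theory Defs
  imports "HOL-Algebra.AbelCoset" "Jordan_Normal_Form.Missing_VectorSpace"
begin

section \<open>Free modules and quotient modules\<close>

text \<open>The ring multiplication and unit of a module record play no role.\<close>

definition free_module :: "('k, 'r) ring_scheme \<Rightarrow> 'x set \<Rightarrow> ('k, 'x \<Rightarrow> 'k) module" where
  "free_module K X =
    \<lparr>carrier = {f. (\<forall>x. f x \<in> carrier K) \<and> (\<forall>x. x \<notin> X \<longrightarrow> f x = \<zero>\<^bsub>K\<^esub>) \<and> finite {x. f x \<noteq> \<zero>\<^bsub>K\<^esub>}},
     mult = (\<lambda>f g. undefined), one = undefined,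
     zero = (\<lambda>x. \<zero>\<^bsub>K\<^esub>),
     add = (\<lambda>f g x. f x \<oplus>\<^bsub>K\<^esub> g x),
     smult = (\<lambda>c f x. c \<otimes>\<^bsub>K\<^esub> f x)\<rparr>"

definition free_gen :: "('k, 'r) ring_scheme \<Rightarrow> 'x \<Rightarrow> 'x \<Rightarrow> 'k" where
  "free_gen K x = (\<lambda>y. if y = x then \<one>\<^bsub>K\<^esub> else \<zero>\<^bsub>K\<^esub>)"

text \<open>In \<open>smult\<close> the submodule is added back so that multiplication by zero also yields a full coset.\<close>

definition quotient_module :: "('k, 'a, 'm) module_scheme \<Rightarrow> 'a set \<Rightarrow> ('k, 'a set) module" where
  "quotient_module M N =
    \<lparr>carrier = a_rcosets\<^bsub>M\<^esub> N,
     mult = (\<lambda>X Y. undefined), one = undefined,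
     zero = N,
     add = (\<lambda>X Y. X <+>\<^bsub>M\<^esub> Y),
     smult = (\<lambda>c X. N <+>\<^bsub>M\<^esub> ((\<lambda>x. c \<odot>\<^bsub>M\<^esub> x) ` X))\<rparr>"

section \<open>Tensor products\<close>

abbreviation tensor_free ::
    "('k, 'r) ring_scheme \<Rightarrow> ('k, 'a, 'm) module_scheme \<Rightarrow> ('k, 'b, 'n) module_scheme
      \<Rightarrow> ('k, 'a \<times> 'b \<Rightarrow> 'k) module" where
  "tensor_free K M N \<equiv> free_module K (carrier M \<times> carrier N)"

definition tensor_relations ::
    "('k, 'r) ring_scheme \<Rightarrow> ('k, 'a, 'm) module_scheme \<Rightarrow> ('k, 'b, 'n) module_scheme
      \<Rightarrow> ('a \<times> 'b \<Rightarrow> 'k) set" where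
  "tensor_relations K M N =
    (let F = tensor_free K M N; \<delta> = (\<lambda>x y. free_gen K (x, y)) in
      {\<delta> (x \<oplus>\<^bsub>M\<^esub> x') y \<ominus>\<^bsub>F\<^esub> (\<delta> x y \<oplus>\<^bsub>F\<^esub> \<delta> x' y) | x x' y.
         x \<in> carrier M \<and> x' \<in> carrier M \<and> y \<in> carrier N} \<union>
      {\<delta> x (y \<oplus>\<^bsub>N\<^esub> y') \<ominus>\<^bsub>F\<^esub> (\<delta> x y \<oplus>\<^bsub>F\<^esub> \<delta> x y') | x y y'.
         x \<in> carrier M \<and> y \<in> carrier N \<and> y' \<in> carrier N} \<union>
      {\<delta> (c \<odot>\<^bsub>M\<^esub> x) y \<ominus>\<^bsub>F\<^esub> (c \<odot>\<^bsub>F\<^esub> \<delta> x y) | c x y.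
         c \<in> carrier K \<and> x \<in> carrier M \<and> y \<in> carrier N} \<union>
      {\<delta> x (c \<odot>\<^bsub>N\<^esub> y) \<ominus>\<^bsub>F\<^esub> (c \<odot>\<^bsub>F\<^esub> \<delta> x y) | c x y.
         c \<in> carrier K \<and> x \<in> carrier M \<and> y \<in> carrier N})"

definition tensor_kernel ::
    "('k, 'r) ring_scheme \<Rightarrow> ('k, 'a, 'm) module_scheme \<Rightarrow> ('k, 'b, 'n) module_scheme
      \<Rightarrow> ('a \<times> 'b \<Rightarrow> 'k) set" where
  "tensor_kernel K M N = module.span K (tensor_free K M N) (tensor_relations K M N)"

definition tensor_space ::
    "('k, 'r) ring_scheme \<Rightarrow> ('k, 'a, 'm) module_scheme \<Rightarrow> ('k, 'b, 'n) module_scheme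
      \<Rightarrow> ('k, ('a \<times> 'b \<Rightarrow> 'k) set) module" where
  "tensor_space K M N = quotient_module (tensor_free K M N) (tensor_kernel K M N)"

definition tensor ::
    "('k, 'r) ring_scheme \<Rightarrow> ('k, 'a, 'm) module_scheme \<Rightarrow> ('k, 'b, 'n) module_scheme
      \<Rightarrow> 'a \<Rightarrow> 'b \<Rightarrow> ('a \<times> 'b \<Rightarrow> 'k) set" where
  "tensor K M N x y = tensor_kernel K M N +>\<^bsub>tensor_free K M N\<^esub> free_gen K (x, y)"

definition bilinear_map ::
    "('k, 'r) ring_scheme \<Rightarrow> ('k, 'a, 'm) module_scheme \<Rightarrow> ('k, 'b, 'n) module_scheme
      \<Rightarrow> ('k, 'c, 'p) module_scheme \<Rightarrow> ('a \<Rightarrow> 'b \<Rightarrow> 'c) \<Rightarrow> bool" where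
  "bilinear_map K M N P \<phi> \<longleftrightarrow>
    (\<forall>x\<in>carrier M. \<phi> x \<in> module_hom K N P) \<and> (\<forall>y\<in>carrier N. (\<lambda>x. \<phi> x y) \<in> module_hom K M P)"

definition free_lift ::
    "('k, 'r) ring_scheme \<Rightarrow> ('k, 'c, 'p) module_scheme \<Rightarrow> ('x \<Rightarrow> 'c) \<Rightarrow> ('x \<Rightarrow> 'k) \<Rightarrow> 'c" where
  "free_lift K P \<phi> f = (\<Oplus>\<^bsub>P\<^esub>x\<in>{x. f x \<noteq> \<zero>\<^bsub>K\<^esub>}. f x \<odot>\<^bsub>P\<^esub> \<phi> x)"

text \<open>The linear map on the tensor product induced by a bilinear map: the common value of
  \<open>free_lift\<close> on all representatives of a coset.\<close>

definition tensor_lift ::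
    "('k, 'r) ring_scheme \<Rightarrow> ('k, 'c, 'p) module_scheme \<Rightarrow> ('a \<Rightarrow> 'b \<Rightarrow> 'c)
      \<Rightarrow> ('a \<times> 'b \<Rightarrow> 'k) set \<Rightarrow> 'c" where
  "tensor_lift K P \<phi> X = (THE z. \<forall>f\<in>X. free_lift K P (\<lambda>(x, y). \<phi> x y) f = z)"

text \<open>For linear \<open>f : M \<rightarrow> P\<close> and \<open>g : N \<rightarrow> Q\<close> this is \<open>f \<otimes> g : M \<otimes> N \<rightarrow> P \<otimes> Q\<close>;
  only the codomains \<open>P\<close> and \<open>Q\<close> are arguments.\<close>

definition tensor_map ::
    "('k, 'r) ring_scheme \<Rightarrow> ('k, 'c, 'p) module_scheme \<Rightarrow> ('k, 'd, 'q) module_scheme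
      \<Rightarrow> ('a \<Rightarrow> 'c) \<Rightarrow> ('b \<Rightarrow> 'd) \<Rightarrow> ('a \<times> 'b \<Rightarrow> 'k) set \<Rightarrow> ('c \<times> 'd \<Rightarrow> 'k) set" where
  "tensor_map K P Q f g = tensor_lift K (tensor_space K P Q) (\<lambda>x y. tensor K P Q (f x) (g y))"

text \<open>The canonical isomorphism \<open>(M \<otimes> N) \<otimes> P \<rightarrow> M \<otimes> (N \<otimes> P)\<close>.\<close>

definition tensor_assoc ::
    "('k, 'r) ring_scheme \<Rightarrow> ('k, 'a, 'm) module_scheme \<Rightarrow> ('k, 'b, 'n) module_scheme
      \<Rightarrow> ('k, 'c, 'p) module_scheme \<Rightarrow> (('a \<times> 'b \<Rightarrow> 'k) set \<times> 'c \<Rightarrow> 'k) set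
      \<Rightarrow> ('a \<times> ('b \<times> 'c \<Rightarrow> 'k) set \<Rightarrow> 'k) set" where
  "tensor_assoc K M N P =
    (let NP = tensor_space K N P; MNP = tensor_space K M NP in
      tensor_lift K MNP (\<lambda>t z. tensor_lift K MNP (\<lambda>x y. tensor K M NP x (tensor K N P y z)) t))"

section \<open>Hom-associative algebras, Rota-Baxter systems, weak pseudotwistors\<close>

text \<open>The multiplication is a linear map \<open>\<mu> : A \<otimes> A \<rightarrow> A\<close>, and \<open>a \<cdot> b\<close> stands for
  \<open>\<mu> (a \<otimes> b)\<close>. Throughout, linear maps matter only on the carriers of their domains.\<close>

abbreviation hom_mult ::
    "('k, 'r) ring_scheme \<Rightarrow> ('k, 'a, 'm) module_scheme \<Rightarrow> (('a \<times> 'a \<Rightarrow> 'k) set \<Rightarrow> 'a)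
      \<Rightarrow> 'a \<Rightarrow> 'a \<Rightarrow> 'a" where
  "hom_mult K A \<mu> a b \<equiv> \<mu> (tensor K A A a b)"

locale hom_associative_algebra = vectorspace K A
  for K :: "('k, 'r) ring_scheme" and A :: "('k, 'a, 'm) module_scheme" +
  fixes \<alpha> :: "'a \<Rightarrow> 'a" and \<mu> :: "('a \<times> 'a \<Rightarrow> 'k) set \<Rightarrow> 'a"
  assumes alpha_linear: "linear_map K A A \<alpha>"
    and mu_linear: "linear_map K (tensor_space K A A) A \<mu>"
    and hom_assoc: "\<lbrakk>a \<in> carrier A; b \<in> carrier A; c \<in> carrier A\<rbrakk> \<Longrightarrow>
      hom_mult K A \<mu> (hom_mult K A \<mu> a b) (\<alpha> c) = hom_mult K A \<mu> (\<alpha> a) (hom_mult K A \<mu> b c)"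
    and alpha_mult: "\<lbrakk>a \<in> carrier A; b \<in> carrier A\<rbrakk> \<Longrightarrow>
      \<alpha> (hom_mult K A \<mu> a b) = hom_mult K A \<mu> (\<alpha> a) (\<alpha> b)"

locale rota_baxter_system = hom_associative_algebra K A \<alpha> \<mu>
  for K :: "('k, 'r) ring_scheme" and A :: "('k, 'a, 'm) module_scheme"
    and \<alpha> :: "'a \<Rightarrow> 'a" and \<mu> :: "('a \<times> 'a \<Rightarrow> 'k) set \<Rightarrow> 'a" +
  fixes R S :: "'a \<Rightarrow> 'a"
  assumes R_linear: "linear_map K A A R"
    and S_linear: "linear_map K A A S"
    and alpha_R: "a \<in> carrier A \<Longrightarrow> \<alpha> (R a) = R (\<alpha> a)"
    and alpha_S: "a \<in> carrier A \<Longrightarrow> \<alpha> (S a) = S (\<alpha> a)"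
    and rota_baxter_R: "\<lbrakk>a \<in> carrier A; b \<in> carrier A\<rbrakk> \<Longrightarrow>
      hom_mult K A \<mu> (R a) (R b) = R (hom_mult K A \<mu> (R a) b \<oplus>\<^bsub>A\<^esub> hom_mult K A \<mu> a (S b))"
    and rota_baxter_S: "\<lbrakk>a \<in> carrier A; b \<in> carrier A\<rbrakk> \<Longrightarrow>
      hom_mult K A \<mu> (S a) (S b) = S (hom_mult K A \<mu> (R a) b \<oplus>\<^bsub>A\<^esub> hom_mult K A \<mu> a (S b))"

text \<open>The threefold tensor power is \<open>(A \<otimes> A) \<otimes> A\<close>; the maps \<open>id \<otimes> T\<close> and \<open>\<alpha> \<otimes> \<mu>\<close> live on
  \<open>A \<otimes> (A \<otimes> A)\<close> and are transported along \<open>tensor_assoc\<close>.\<close>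

definition weak_companion ::
    "('k, 'r) ring_scheme \<Rightarrow> ('k, 'a, 'm) module_scheme \<Rightarrow> ('a \<Rightarrow> 'a)
      \<Rightarrow> (('a \<times> 'a \<Rightarrow> 'k) set \<Rightarrow> 'a)
      \<Rightarrow> (('a \<times> 'a \<Rightarrow> 'k) set \<Rightarrow> ('a \<times> 'a \<Rightarrow> 'k) set)
      \<Rightarrow> ((('a \<times> 'a \<Rightarrow> 'k) set \<times> 'a \<Rightarrow> 'k) set \<Rightarrow> (('a \<times> 'a \<Rightarrow> 'k) set \<times> 'a \<Rightarrow> 'k) set)
      \<Rightarrow> bool" where
  "weak_companion K A \<alpha> \<mu> T \<tau> \<longleftrightarrow>
    (let A2 = tensor_space K A A;
         A3 = tensor_space K A2 A;
         \<alpha>3 = tensor_map K A2 A (tensor_map K A A \<alpha> \<alpha>) \<alpha>;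
         assoc = tensor_assoc K A A A;
         id_T = tensor_map K A A2 id T;
         T_id = tensor_map K A2 A T id;
         \<alpha>_\<mu> = tensor_map K A A \<alpha> \<mu>;
         \<mu>_\<alpha> = tensor_map K A A \<mu> \<alpha>
     in linear_map K A3 A3 \<tau> \<and>
        (\<forall>w\<in>carrier A3. \<alpha>3 (\<tau> w) = \<tau> (\<alpha>3 w)) \<and>
        (\<forall>w\<in>carrier A3. T (\<alpha>_\<mu> (id_T (assoc w))) = \<alpha>_\<mu> (assoc (\<tau> w))) \<and>
        (\<forall>w\<in>carrier A3. T (\<mu>_\<alpha> (T_id w)) = \<mu>_\<alpha> (\<tau> w)))"

definition weak_pseudotwistor ::
    "('k, 'r) ring_scheme \<Rightarrow> ('k, 'a, 'm) module_scheme \<Rightarrow> ('a \<Rightarrow> 'a)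
      \<Rightarrow> (('a \<times> 'a \<Rightarrow> 'k) set \<Rightarrow> 'a)
      \<Rightarrow> (('a \<times> 'a \<Rightarrow> 'k) set \<Rightarrow> ('a \<times> 'a \<Rightarrow> 'k) set) \<Rightarrow> bool" where
  "weak_pseudotwistor K A \<alpha> \<mu> T \<longleftrightarrow>
    linear_map K (tensor_space K A A) (tensor_space K A A) T \<and>
    (\<forall>t\<in>carrier (tensor_space K A A).
       tensor_map K A A \<alpha> \<alpha> (T t) = T (tensor_map K A A \<alpha> \<alpha> t)) \<and>
    (\<exists>\<tau>. weak_companion K A \<alpha> \<mu> T \<tau>)"

section \<open>Universal property of the tensor product\<close>

text \<open>The tensor product is a vector space, \<open>tensor\<close> is bilinear, \<open>tensor_lift\<close> is the linear map
  induced by a bilinear one (\<open>tensor_lift_hom\<close>, \<open>tensor_lift_tensor\<close>), linear maps on the tensor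
  product are determined by pure tensors (\<open>tensor_hom_unique\<close>), and \<open>tensor_map\<close> and
  \<open>tensor_assoc\<close> are linear with the expected values on pure tensors.\<close>

lemma module_hom_comp:
  "f \<in> module_hom K M N \<Longrightarrow> g \<in> module_hom K N P \<Longrightarrow> (\<lambda>x. g (f x)) \<in> module_hom K M P"
  by (auto simp: module_hom_def Pi_iff)

lemma free_module_simps [simp]:
  "\<zero>\<^bsub>free_module K X\<^esub> = (\<lambda>x. \<zero>\<^bsub>K\<^esub>)"
  "f \<oplus>\<^bsub>free_module K X\<^esub> g = (\<lambda>x. f x \<oplus>\<^bsub>K\<^esub> g x)"
  "c \<odot>\<^bsub>free_module K X\<^esub> f = (\<lambda>x. c \<otimes>\<^bsub>K\<^esub> f x)"
  by (simp_all add: free_module_def)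

lemma free_module_carrier:
  "f \<in> carrier (free_module K X) \<longleftrightarrow>
    (\<forall>x. f x \<in> carrier K) \<and> (\<forall>x. x \<notin> X \<longrightarrow> f x = \<zero>\<^bsub>K\<^esub>) \<and> finite {x. f x \<noteq> \<zero>\<^bsub>K\<^esub>}"
  by (simp add: free_module_def)

lemma free_module_is_module:
  fixes K (structure)
  assumes "cring K"
  shows "module K (free_module K X)"
proof -
  interpret cring K by fact
  show ?thesis
  proof (rule module_criteria, unfold free_module_simps, goal_cases)
    case 3
    show ?case
    proof (intro allI impI, elim conjE)
      fix f g assume fg: "f \<in> carrier (free_module K X)" "g \<in> carrier (free_module K X)"
      have "{x. f x \<oplus> g x \<noteq> \<zero>} \<subseteq> {x. f x \<noteq> \<zero>} \<union> {x. g x \<noteq> \<zero>}" by auto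
      then have "finite {x. f x \<oplus> g x \<noteq> \<zero>}"
        by (rule finite_subset) (use fg in \<open>simp add: free_module_carrier\<close>)
      then show "(\<lambda>x. f x \<oplus> g x) \<in> carrier (free_module K X)"
        using fg by (simp add: free_module_carrier)
    qed
  next
    case 4
    show ?case
    proof
      fix f assume f: "f \<in> carrier (free_module K X)"
      have "{x. \<ominus> f x \<noteq> \<zero>} \<subseteq> {x. f x \<noteq> \<zero>}" using f by (auto simp: free_module_carrier)
      then have "finite {x. \<ominus> f x \<noteq> \<zero>}"
        by (rule finite_subset) (use f in \<open>simp add: free_module_carrier\<close>)
      then have "(\<lambda>x. \<ominus> f x) \<in> carrier (free_module K X)"
        using f by (simp add: free_module_carrier)
      moreover have "(\<lambda>x. f x \<oplus> \<ominus> f x) = (\<lambda>x. \<zero>)"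
        using f by (simp add: free_module_carrier r_neg)
      ultimately show "\<exists>g\<in>carrier (free_module K X). (\<lambda>x. f x \<oplus> g x) = (\<lambda>x. \<zero>)"
        by (intro bexI[where x = "\<lambda>x. \<ominus> f x"])
    qed
  next
    case 5
    show ?case
    proof (intro allI impI, elim conjE)
      fix c f assume cf: "c \<in> carrier K" "f \<in> carrier (free_module K X)"
      have "{x. c \<otimes> f x \<noteq> \<zero>} \<subseteq> {x. f x \<noteq> \<zero>}" using cf by auto
      then have "finite {x. c \<otimes> f x \<noteq> \<zero>}"
        by (rule finite_subset) (use cf in \<open>simp add: free_module_carrier\<close>)
      then show "(\<lambda>x. c \<otimes> f x) \<in> carrier (free_module K X)"
        using cf by (auto simp: free_module_carrier)
    qed
  qed (use assms in \<open>auto simp: free_module_carrier a_ac m_assoc l_distr r_distr\<close>)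
qed

lemma free_gen_closed:
  fixes K (structure)
  assumes "cring K" "x \<in> X"
  shows "free_gen K x \<in> carrier (free_module K X)"
proof -
  interpret cring K by fact
  have "{y. free_gen K x y \<noteq> \<zero>} \<subseteq> {x}" by (auto simp: free_gen_def)
  then have "finite {y. free_gen K x y \<noteq> \<zero>}"
    by (rule finite_subset) simp
  then show ?thesis
    using assms(2) by (auto simp: free_module_carrier free_gen_def)
qed

lemma free_lift_superset:
  assumes "module K P" "finite B" "{x. f x \<noteq> \<zero>\<^bsub>K\<^esub>} \<subseteq> B" "\<And>x. f x \<in> carrier K"
    "\<And>x. x \<in> B \<Longrightarrow> \<phi> x \<in> carrier P"
  shows "free_lift K P \<phi> f = (\<Oplus>\<^bsub>P\<^esub>x\<in>B. f x \<odot>\<^bsub>P\<^esub> \<phi> x)"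
proof -
  interpret module K P by fact
  show ?thesis unfolding free_lift_def
    by (rule M.add.finprod_mono_neutral_cong_left) (use assms in auto)
qed

lemma free_lift_gen:
  assumes "module K P" "\<phi> x \<in> carrier P"
  shows "free_lift K P \<phi> (free_gen K x) = \<phi> x"
proof -
  interpret module K P by fact
  have "free_lift K P \<phi> (free_gen K x) = (\<Oplus>\<^bsub>P\<^esub>y\<in>{x}. free_gen K x y \<odot>\<^bsub>P\<^esub> \<phi> y)"
    by (rule free_lift_superset) (use assms in \<open>auto simp: free_gen_def\<close>)
  then show ?thesis using assms by (simp add: free_gen_def)
qed

lemma free_lift_hom:
  fixes K (structure)
  assumes "module K P" "\<And>x. x \<in> X \<Longrightarrow> \<phi> x \<in> carrier P"
  shows "free_lift K P \<phi> \<in> module_hom K (free_module K X) P"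
proof -
  interpret module K P by fact
  have supp: "{x. f x \<noteq> \<zero>} \<subseteq> X" if "f \<in> carrier (free_module K X)" for f
    using that by (auto simp: free_module_carrier)
  show ?thesis unfolding module_hom_def
  proof (intro CollectI conjI allI impI funcsetI; (elim conjE)?)
    fix f assume f: "f \<in> carrier (free_module K X)"
    show "free_lift K P \<phi> f \<in> carrier P" unfolding free_lift_def
      by (rule M.finsum_closed) (use f supp[OF f] assms(2) in \<open>auto simp: free_module_carrier\<close>)
  next
    fix f g assume fg: "f \<in> carrier (free_module K X)" "g \<in> carrier (free_module K X)"
    let ?B = "{x. f x \<noteq> \<zero>} \<union> {x. g x \<noteq> \<zero>}"
    have B: "finite ?B" "\<And>x. x \<in> ?B \<Longrightarrow> \<phi> x \<in> carrier P" 
      using fg supp assms(2) by (auto simp: free_module_carrier)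
    have c: "f x \<in> carrier K" "g x \<in> carrier K" for x using fg by (auto simp: free_module_carrier)
    have "free_lift K P \<phi> (\<lambda>x. f x \<oplus> g x) = (\<Oplus>\<^bsub>P\<^esub>x\<in>?B. (f x \<oplus> g x) \<odot>\<^bsub>P\<^esub> \<phi> x)"
      by (rule free_lift_superset) (use B c assms(1) in auto)
    also have "\<dots> = (\<Oplus>\<^bsub>P\<^esub>x\<in>?B. f x \<odot>\<^bsub>P\<^esub> \<phi> x \<oplus>\<^bsub>P\<^esub> g x \<odot>\<^bsub>P\<^esub> \<phi> x)"
      by (rule M.finsum_cong') (use B c in \<open>auto simp: smult_l_distr\<close>)
    also have "\<dots> = (\<Oplus>\<^bsub>P\<^esub>x\<in>?B. f x \<odot>\<^bsub>P\<^esub> \<phi> x) \<oplus>\<^bsub>P\<^esub> (\<Oplus>\<^bsub>P\<^esub>x\<in>?B. g x \<odot>\<^bsub>P\<^esub> \<phi> x)"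
      by (rule M.finsum_addf) (use B c in auto)
    also have "(\<Oplus>\<^bsub>P\<^esub>x\<in>?B. f x \<odot>\<^bsub>P\<^esub> \<phi> x) = free_lift K P \<phi> f"
      by (rule free_lift_superset[symmetric]) (use B c assms(1) in auto)
    also have "(\<Oplus>\<^bsub>P\<^esub>x\<in>?B. g x \<odot>\<^bsub>P\<^esub> \<phi> x) = free_lift K P \<phi> g"
      by (rule free_lift_superset[symmetric]) (use B c assms(1) in auto)
    finally show "free_lift K P \<phi> (f \<oplus>\<^bsub>free_module K X\<^esub> g) =
        free_lift K P \<phi> f \<oplus>\<^bsub>P\<^esub> free_lift K P \<phi> g" by simp
  next
    fix c f assume cf: "c \<in> carrier K" "f \<in> carrier (free_module K X)"
    let ?B = "{x. f x \<noteq> \<zero>}"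
    have B: "finite ?B" "\<And>x. x \<in> ?B \<Longrightarrow> \<phi> x \<in> carrier P" 
      using cf supp assms(2) by (auto simp: free_module_carrier)
    have fc: "f x \<in> carrier K" for x using cf by (auto simp: free_module_carrier)
    have "free_lift K P \<phi> (\<lambda>x. c \<otimes> f x) = (\<Oplus>\<^bsub>P\<^esub>x\<in>?B. (c \<otimes> f x) \<odot>\<^bsub>P\<^esub> \<phi> x)"
      by (rule free_lift_superset) (use B cf fc assms(1) in auto)
    also have "\<dots> = (\<Oplus>\<^bsub>P\<^esub>x\<in>?B. c \<odot>\<^bsub>P\<^esub> (f x \<odot>\<^bsub>P\<^esub> \<phi> x))"
      by (rule M.finsum_cong') (use B cf fc in \<open>auto simp: smult_assoc1\<close>)
    also have "\<dots> = c \<odot>\<^bsub>P\<^esub> free_lift K P \<phi> f" unfolding free_lift_def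
      by (rule finsum_smult_ldistr[symmetric]) (use B cf fc in auto)
    finally show "free_lift K P \<phi> (c \<odot>\<^bsub>free_module K X\<^esub> f) = c \<odot>\<^bsub>P\<^esub> free_lift K P \<phi> f" by simp
  qed
qed

lemma free_module_hom_eq:
  fixes K (structure)
  assumes K: "cring K" and P: "module K P"
    and h: "h \<in> module_hom K (free_module K X) P"
    and f: "f \<in> carrier (free_module K X)"
  shows "h f = free_lift K P (\<lambda>x. h (free_gen K x)) f"
proof -
  interpret module K P by fact
  interpret F: module K "free_module K X" by (rule free_module_is_module[OF K])
  let ?L = "free_lift K P (\<lambda>x. h (free_gen K x))"
  have hg: "h (free_gen K x) \<in> carrier P" if "x \<in> X" for x
    using module_hom_closed[OF h] free_gen_closed[OF K that] by auto
  have L: "?L \<in> module_hom K (free_module K X) P" by (rule free_lift_hom[OF P hg])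
  interpret h: mod_hom K "free_module K X" P h
    by (intro mod_hom.intro mod_hom_axioms.intro F.module_axioms P h) 
  interpret L: mod_hom K "free_module K X" P ?L
    by (intro mod_hom.intro mod_hom_axioms.intro F.module_axioms P L)
  have "finite B \<Longrightarrow> f \<in> carrier (free_module K X) \<Longrightarrow> {x. f x \<noteq> \<zero>} = B \<Longrightarrow> h f = ?L f" for B f
  proof (induction B arbitrary: f rule: finite_induct)
    case empty
    then have "f = \<zero>\<^bsub>free_module K X\<^esub>" by auto
    then show ?case using h.f0_is_0 L.f0_is_0 by simp
  next
    case (insert x B)
    let ?g = "f(x := \<zero>)"
    have xX: "x \<in> X" using insert.prems by (auto simp: free_module_carrier)
    have e: "{y. ?g y \<noteq> \<zero>} = B" using insert.prems insert.hyps by auto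
    then have g: "?g \<in> carrier (free_module K X)" 
      using insert by (auto simp: free_module_carrier)
    have fc: "f y \<in> carrier K" for y using insert.prems by (auto simp: free_module_carrier)
    have dec: "f = ?g \<oplus>\<^bsub>free_module K X\<^esub> (f x \<odot>\<^bsub>free_module K X\<^esub> free_gen K x)"
      by (auto simp: free_gen_def fc)
    have gen: "free_gen K x \<in> carrier (free_module K X)" by (rule free_gen_closed[OF K xX])
    have sg: "f x \<odot>\<^bsub>free_module K X\<^esub> free_gen K x \<in> carrier (free_module K X)" 
      by (rule F.smult_closed[OF fc gen])
    have 1: "h f = h ?g \<oplus>\<^bsub>P\<^esub> f x \<odot>\<^bsub>P\<^esub> h (free_gen K x)"
      by (subst dec, subst h.f_add[OF g sg], subst h.f_smult[OF fc gen]) simp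
    have 2: "?L f = ?L ?g \<oplus>\<^bsub>P\<^esub> f x \<odot>\<^bsub>P\<^esub> ?L (free_gen K x)"
      by (subst dec, subst L.f_add[OF g sg], subst L.f_smult[OF fc gen]) simp
    show ?case unfolding 1 2 insert.IH[OF g e] free_lift_gen[where \<phi>="\<lambda>x. h (free_gen K x)", OF P hg[OF xX]] ..
  qed
  then show ?thesis using f by (auto simp: free_module_carrier)
qed

locale quot = M: module K M for K and M (structure) +
  fixes N assumes sub: "submodule K N M"
begin

abbreviation "Q \<equiv> quotient_module M N"

sublocale N: abelian_subgroup N M
proof (rule abelian_subgroupI3)
  have *: "\<ominus> x \<in> N" if "x \<in> N" for x
  proof -
    have "x \<in> carrier M" using that sub by (auto simp: submodule_def)
    then have "\<ominus> x = (\<ominus>\<^bsub>K\<^esub> \<one>\<^bsub>K\<^esub>) \<odot> x" by (simp add: M.smult_minus_1)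
    then show ?thesis using sub that by (simp add: submodule_def)
  qed
  show "additive_subgroup N M"
    by (intro additive_subgroup.intro M.add.subgroupI)
       (use sub * in \<open>auto simp: submodule_def\<close>)
qed (rule M.M.abelian_group_axioms)

lemma quotient_simps:
  "carrier Q = (\<lambda>x. N +> x) ` carrier M"
  "\<zero>\<^bsub>Q\<^esub> = N +> \<zero>"
  "\<lbrakk>x \<in> carrier M; y \<in> carrier M\<rbrakk> \<Longrightarrow> (N +> x) \<oplus>\<^bsub>Q\<^esub> (N +> y) = N +> (x \<oplus> y)"
  using N.a_subset
  by (auto simp: quotient_module_def A_RCOSETS_def' N.a_rcos_sum)

lemma quotient_smult:
  assumes c: "c \<in> carrier K" and x: "x \<in> carrier M"
  shows "c \<odot>\<^bsub>Q\<^esub> (N +> x) = N +> (c \<odot> x)"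
proof -
  have Nc: "n \<in> carrier M" if "n \<in> N" for n using that N.a_subset by auto
  have "N <+>\<^bsub>M\<^esub> ((\<lambda>x. c \<odot> x) ` (N +> x)) = N +> (c \<odot> x)"
  proof (intro subset_antisym subsetI)
    fix z assume "z \<in> N <+>\<^bsub>M\<^esub> ((\<lambda>x. c \<odot> x) ` (N +> x))"
    then obtain n m where nm: "n \<in> N" "m \<in> N" "z = n \<oplus> c \<odot> (m \<oplus> x)"
      by (auto simp: set_add_def' a_r_coset_def')
    then have "z = (n \<oplus> c \<odot> m) \<oplus> c \<odot> x"
      using c x Nc by (simp add: M.smult_r_distr M.M.a_assoc)
    moreover have "n \<oplus> c \<odot> m \<in> N" using nm c sub by (simp add: submodule_def)
    ultimately show "z \<in> N +> (c \<odot> x)" by (auto simp: a_r_coset_def')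
  next
    fix z assume "z \<in> N +> (c \<odot> x)"
    then obtain n where n: "n \<in> N" "z = n \<oplus> c \<odot> x" by (auto simp: a_r_coset_def')
    moreover have "x \<in> N +> x" using x by (rule N.a_rcos_self)
    ultimately show "z \<in> N <+>\<^bsub>M\<^esub> ((\<lambda>x. c \<odot> x) ` (N +> x))"
      by (auto simp: set_add_def')
  qed
  then show ?thesis by (simp add: quotient_module_def)
qed

lemma quotient_is_module: "module K Q"
proof (rule module_criteria)
  show "\<forall>v\<in>carrier Q. \<exists>w\<in>carrier Q. v \<oplus>\<^bsub>Q\<^esub> w = \<zero>\<^bsub>Q\<^esub>"
  proof
    fix v assume "v \<in> carrier Q"
    then obtain x where x: "x \<in> carrier M" "v = N +> x" by (auto simp: quotient_simps)
    show "\<exists>w\<in>carrier Q. v \<oplus>\<^bsub>Q\<^esub> w = \<zero>\<^bsub>Q\<^esub>"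
      by (rule bexI[of _ "N +> (\<ominus> x)"]) (use x in \<open>auto simp: quotient_simps M.M.r_neg\<close>)
  qed
qed (use M.R.cring_axioms in \<open>auto simp: quotient_simps quotient_smult M.M.a_ac M.smult_l_distr M.smult_r_distr
      M.smult_assoc1\<close>)

lemma proj_hom: "(\<lambda>x. N +> x) \<in> module_hom K M Q"
  by (auto simp: module_hom_def quotient_simps quotient_smult)

lemma coset_eqI:
  assumes "x \<in> carrier M" "y \<in> carrier M" "x \<ominus> y \<in> N"
  shows "N +> x = N +> y"
proof -
  have "x \<in> N +> y"
    using assms by (auto simp: a_r_coset_def' a_minus_def M.M.a_assoc M.M.l_neg intro!: bexI[of _ "x \<ominus> y"])
  then show ?thesis
    using N.a_subgroup assms(2) M.M.a_repr_independence by metis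
qed

end

locale tensor_pair = M: module K M + N: module K N for K M N
begin

abbreviation "F \<equiv> tensor_free K M N"
abbreviation "T \<equiv> tensor_space K M N"

sublocale F: module K F by (rule free_module_is_module[OF M.R.cring_axioms])

lemma gen: "x \<in> carrier M \<Longrightarrow> y \<in> carrier N \<Longrightarrow> free_gen K (x, y) \<in> carrier F"
  by (rule free_gen_closed[OF M.R.cring_axioms]) simp

lemma relations_closed: "tensor_relations K M N \<subseteq> carrier F"
  unfolding tensor_relations_def Let_def
  by (safe; intro F.M.minus_closed F.M.a_closed F.smult_closed gen
      M.M.a_closed N.M.a_closed M.smult_closed N.smult_closed)

sublocale quot K F "tensor_kernel K M N"
  unfolding tensor_kernel_def
  by (rule quot.intro[OF F.module_axioms quot_axioms.intro[OF F.span_is_submodule[OF relations_closed]]])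

lemma relations_kernel: "r \<in> tensor_relations K M N \<Longrightarrow> r \<in> tensor_kernel K M N"
  using F.in_own_span[OF relations_closed] by (auto simp: tensor_kernel_def)

lemma tensor_space_is_module: "module K T"
  unfolding tensor_space_def by (rule quotient_is_module)

lemma tensor_bilinear: "bilinear_map K M N T (tensor K M N)"
proof -
  let ?c = "\<lambda>f. tensor_kernel K M N +>\<^bsub>F\<^esub> f"
  have cl: "tensor K M N x y \<in> carrier T" if "x \<in> carrier M" "y \<in> carrier N" for x y
    unfolding tensor_def tensor_space_def quotient_simps by (intro imageI gen that)
  have a1: "tensor K M N (x \<oplus>\<^bsub>M\<^esub> x') y = tensor K M N x y \<oplus>\<^bsub>T\<^esub> tensor K M N x' y"
    if "x \<in> carrier M" "x' \<in> carrier M" "y \<in> carrier N" for x x' y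
    unfolding tensor_def tensor_space_def quotient_simps(3)[OF gen[OF that(1,3)] gen[OF that(2,3)]]
    by (rule coset_eqI[OF _ _ relations_kernel],
        (intro F.M.a_closed F.smult_closed gen that M.M.a_closed N.M.a_closed M.smult_closed N.smult_closed)+)
       (unfold tensor_relations_def Let_def, use that in blast)
  have a2: "tensor K M N x (y \<oplus>\<^bsub>N\<^esub> y') = tensor K M N x y \<oplus>\<^bsub>T\<^esub> tensor K M N x y'"
    if "x \<in> carrier M" "y \<in> carrier N" "y' \<in> carrier N" for x y y'
    unfolding tensor_def tensor_space_def quotient_simps(3)[OF gen[OF that(1,2)] gen[OF that(1,3)]]
    by (rule coset_eqI[OF _ _ relations_kernel],
        (intro F.M.a_closed F.smult_closed gen that M.M.a_closed N.M.a_closed M.smult_closed N.smult_closed)+)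
       (unfold tensor_relations_def Let_def, use that in blast)
  have a3: "tensor K M N (c \<odot>\<^bsub>M\<^esub> x) y = c \<odot>\<^bsub>T\<^esub> tensor K M N x y"
    if "c \<in> carrier K" "x \<in> carrier M" "y \<in> carrier N" for c x y
    unfolding tensor_def tensor_space_def quotient_smult[OF that(1) gen[OF that(2,3)]]
    by (rule coset_eqI[OF _ _ relations_kernel],
        (intro F.M.a_closed F.smult_closed gen that M.M.a_closed N.M.a_closed M.smult_closed N.smult_closed)+)
       (unfold tensor_relations_def Let_def, use that in blast)
  have a4: "tensor K M N x (c \<odot>\<^bsub>N\<^esub> y) = c \<odot>\<^bsub>T\<^esub> tensor K M N x y"
    if "c \<in> carrier K" "x \<in> carrier M" "y \<in> carrier N" for c x y
    unfolding tensor_def tensor_space_def quotient_smult[OF that(1) gen[OF that(2,3)]]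
    by (rule coset_eqI[OF _ _ relations_kernel],
        (intro F.M.a_closed F.smult_closed gen that M.M.a_closed N.M.a_closed M.smult_closed N.smult_closed)+)
       (unfold tensor_relations_def Let_def, use that in blast)
  show ?thesis
    using cl a1 a2 a3 a4 by (simp add: bilinear_map_def module_hom_def)
qed

context
  fixes P \<phi> assumes P: "module K P" and bil: "bilinear_map K M N P \<phi>"
begin

lemma phi_closed: "x \<in> carrier M \<Longrightarrow> y \<in> carrier N \<Longrightarrow> \<phi> x y \<in> carrier P"
  using bil by (auto simp: bilinear_map_def module_hom_def)

lemma free_lift_phi: "free_lift K P (\<lambda>(x, y). \<phi> x y) \<in> module_hom K F P"
  by (rule free_lift_hom[OF P]) (use phi_closed in auto)

interpretation P: module K P by (rule P)
interpretation L: mod_hom K F P "free_lift K P (\<lambda>(x, y). \<phi> x y)"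
  by (intro mod_hom.intro mod_hom_axioms.intro F.module_axioms P free_lift_phi)

lemma lift_gen: "x \<in> carrier M \<Longrightarrow> y \<in> carrier N \<Longrightarrow>
  free_lift K P (\<lambda>(x, y). \<phi> x y) (free_gen K (x, y)) = \<phi> x y"
  using free_lift_gen[OF P, of "\<lambda>(x, y). \<phi> x y" "(x, y)"] phi_closed by simp

lemma relations_ker: "tensor_relations K M N \<subseteq> L.ker"
proof -
  let ?L = "free_lift K P (\<lambda>(x, y). \<phi> x y)"
  note cl = F.M.minus_closed F.M.a_closed F.smult_closed gen
      M.M.a_closed N.M.a_closed M.smult_closed N.smult_closed
  have h1: "\<phi> x \<in> module_hom K N P" if "x \<in> carrier M" for x
    using bil that by (simp add: bilinear_map_def)
  have h2: "(\<lambda>x. \<phi> x y) \<in> module_hom K M P" if "y \<in> carrier N" for y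
    using bil that by (simp add: bilinear_map_def)
  have k: "u \<ominus>\<^bsub>F\<^esub> v \<in> L.ker" if "u \<in> carrier F" "v \<in> carrier F" "?L u = ?L v" for u v
    unfolding L.ker_def using that L.f_im P.M.r_neg
    by (simp del: free_module_simps add: a_minus_def)
  show ?thesis
    unfolding tensor_relations_def Let_def
  proof (safe, goal_cases)
    case (1 _ x x' y)
    show ?case
      by (rule k) (use 1 module_hom_add[OF h2] in \<open>simp_all del: free_module_simps add: cl lift_gen\<close>)
  next
    case (2 _ x y y')
    show ?case
      by (rule k) (use 2 module_hom_add[OF h1] in \<open>simp_all del: free_module_simps add: cl lift_gen\<close>)
  next
    case (3 _ c x y)
    show ?case
      by (rule k) (use 3 module_hom_smult[OF h2] in \<open>simp_all del: free_module_simps add: cl lift_gen\<close>)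
  next
    case (4 _ c x y)
    show ?case
      by (rule k) (use 4 module_hom_smult[OF h1] in \<open>simp_all del: free_module_simps add: cl lift_gen\<close>)
  qed
qed

lemma kernel_ker: "tensor_kernel K M N \<subseteq> L.ker"
  unfolding tensor_kernel_def by (rule F.span_is_subset[OF relations_ker L.ker_is_submodule])

lemma tensor_lift_coset:
  assumes f: "f \<in> carrier F"
  shows "tensor_lift K P \<phi> (tensor_kernel K M N +>\<^bsub>F\<^esub> f) = free_lift K P (\<lambda>(x, y). \<phi> x y) f"
proof -
  have 1: "free_lift K P (\<lambda>(x, y). \<phi> x y) g = free_lift K P (\<lambda>(x, y). \<phi> x y) f"
    if g: "g \<in> tensor_kernel K M N +>\<^bsub>F\<^esub> f" for g
  proof -
    obtain n where n: "n \<in> tensor_kernel K M N" "g = n \<oplus>\<^bsub>F\<^esub> f"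
      using g by (auto simp del: free_module_simps simp: a_r_coset_def')
    then have "n \<in> L.ker" using kernel_ker by auto
    then show ?thesis unfolding n(2) using f L.f_im
      by (simp del: free_module_simps add: L.ker_def)
  qed
  have 2: "f \<in> tensor_kernel K M N +>\<^bsub>F\<^esub> f" by (rule N.a_rcos_self[OF f])
  show ?thesis unfolding tensor_lift_def
  proof (rule the_equality)
    show "\<forall>g\<in>tensor_kernel K M N +>\<^bsub>F\<^esub> f.
        free_lift K P (\<lambda>(x, y). \<phi> x y) g = free_lift K P (\<lambda>(x, y). \<phi> x y) f"
      by (rule ballI) (rule 1)
  next
    fix z assume "\<forall>g\<in>tensor_kernel K M N +>\<^bsub>F\<^esub> f. free_lift K P (\<lambda>(x, y). \<phi> x y) g = z"
    from this[rule_format, OF 2] show "z = free_lift K P (\<lambda>(x, y). \<phi> x y) f" by (rule sym)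
  qed
qed

lemma tensor_lift_hom: "tensor_lift K P \<phi> \<in> module_hom K T P"
proof -
  have "tensor_lift K P \<phi> X \<in> carrier P" if "X \<in> carrier T" for X
    using that L.f_im unfolding tensor_space_def quotient_simps(1)
    by (elim imageE) (simp add: tensor_lift_coset)
  moreover have "tensor_lift K P \<phi> (X \<oplus>\<^bsub>T\<^esub> Y) = tensor_lift K P \<phi> X \<oplus>\<^bsub>P\<^esub> tensor_lift K P \<phi> Y"
    if XY: "X \<in> carrier T" "Y \<in> carrier T" for X Y
  proof -
    obtain f g where "f \<in> carrier F" "g \<in> carrier F" "X = tensor_kernel K M N +>\<^bsub>F\<^esub> f"
      "Y = tensor_kernel K M N +>\<^bsub>F\<^esub> g"
      using XY unfolding tensor_space_def quotient_simps(1) by blast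
    then show ?thesis unfolding tensor_space_def
      using quotient_simps(3)[of f g] tensor_lift_coset[of f] tensor_lift_coset[of g]
        tensor_lift_coset[of "f \<oplus>\<^bsub>F\<^esub> g"] F.M.a_closed[of f g] L.f_add[of f g]
      by (simp del: free_module_simps L.f_add)
  qed
  moreover have "tensor_lift K P \<phi> (c \<odot>\<^bsub>T\<^esub> X) = c \<odot>\<^bsub>P\<^esub> tensor_lift K P \<phi> X"
    if cX: "c \<in> carrier K" "X \<in> carrier T" for c X
  proof -
    obtain f where "f \<in> carrier F" "X = tensor_kernel K M N +>\<^bsub>F\<^esub> f"
      using cX(2) unfolding tensor_space_def quotient_simps(1) by blast
    then show ?thesis unfolding tensor_space_def
      using cX(1) quotient_smult[of c f] tensor_lift_coset[of f]
        tensor_lift_coset[of "c \<odot>\<^bsub>F\<^esub> f"] F.smult_closed[of c f] L.f_smult[of c f]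
      by (simp del: free_module_simps L.f_smult)
  qed
  ultimately show ?thesis by (simp add: module_hom_def)
qed

lemma tensor_lift_tensor:
  "x \<in> carrier M \<Longrightarrow> y \<in> carrier N \<Longrightarrow> tensor_lift K P \<phi> (tensor K M N x y) = \<phi> x y"
  unfolding tensor_def by (simp add: tensor_lift_coset gen lift_gen)

end

lemma tensor_hom_unique:
  assumes P: "module K P" and f: "f \<in> module_hom K T P" and g: "g \<in> module_hom K T P"
    and eq: "\<And>x y. x \<in> carrier M \<Longrightarrow> y \<in> carrier N \<Longrightarrow> f (tensor K M N x y) = g (tensor K M N x y)"
    and t: "t \<in> carrier T"
  shows "f t = g t"
proof -
  let ?c = "\<lambda>u. tensor_kernel K M N +>\<^bsub>F\<^esub> u"
  have hom: "(\<lambda>u. h (?c u)) \<in> module_hom K F P" if "h \<in> module_hom K T P" for h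
    using module_hom_comp[OF proj_hom that[unfolded tensor_space_def]] .
  obtain u where u: "u \<in> carrier F" "t = ?c u" 
    using t unfolding tensor_space_def quotient_simps by auto
  interpret P: module K P by (rule P)
  have "free_lift K P (\<lambda>x. f (?c (free_gen K x))) u = free_lift K P (\<lambda>x. g (?c (free_gen K x))) u"
    unfolding free_lift_def
  proof (rule P.M.finsum_cong'[OF refl])
    have gc: "g (?c (free_gen K x)) \<in> carrier P" if "x \<in> carrier M \<times> carrier N" for x
      using that module_hom_closed[OF hom[OF g]] gen by (cases x) auto
    show "(\<lambda>x. u x \<odot>\<^bsub>P\<^esub> g (?c (free_gen K x))) \<in> {x. u x \<noteq> \<zero>\<^bsub>K\<^esub>} \<rightarrow> carrier P"
    proof
      fix x assume x: "x \<in> {x. u x \<noteq> \<zero>\<^bsub>K\<^esub>}"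
      then have "x \<in> carrier M \<times> carrier N" using u(1) unfolding free_module_carrier by blast
      moreover have "u x \<in> carrier K" using u(1) unfolding free_module_carrier by blast
      ultimately show "u x \<odot>\<^bsub>P\<^esub> g (?c (free_gen K x)) \<in> carrier P" using gc by simp
    qed
    show "u x \<odot>\<^bsub>P\<^esub> f (?c (free_gen K x)) = u x \<odot>\<^bsub>P\<^esub> g (?c (free_gen K x))"
      if "x \<in> {x. u x \<noteq> \<zero>\<^bsub>K\<^esub>}" for x
    proof -
      have "x \<in> carrier M \<times> carrier N" using that u(1) unfolding free_module_carrier by blast
      then show ?thesis using eq by (cases x) (simp add: tensor_def)
    qed
  qed
  then show ?thesis
    using free_module_hom_eq[OF M.R.cring_axioms P hom[OF f] u(1)]
      free_module_hom_eq[OF M.R.cring_axioms P hom[OF g] u(1)] u(2) by simp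
qed

end


lemma tensor_space_vectorspace:
  assumes "vectorspace K M" "vectorspace K N"
  shows "vectorspace K (tensor_space K M N)"
  using assms tensor_pair.tensor_space_is_module[of K M N]
  by (simp add: vectorspace_def tensor_pair_def)

lemma bilinear_map_comp:
  assumes "bilinear_map K P Q L \<phi>" "f \<in> module_hom K M P" "g \<in> module_hom K N Q"
  shows "bilinear_map K M N L (\<lambda>x y. \<phi> (f x) (g y))"
proof -
  have "f x \<in> carrier P" if "x \<in> carrier M" for x using that assms(2) by (auto simp: module_hom_def)
  moreover have "g x \<in> carrier Q" if "x \<in> carrier N" for x using that assms(3) by (auto simp: module_hom_def)
  ultimately show ?thesis using assms module_hom_comp[OF assms(3)] 
      module_hom_comp[OF assms(2), of "\<lambda>x. \<phi> x y" for y] unfolding bilinear_map_def by blast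
qed


lemma tensor_pairI: "vectorspace K M \<Longrightarrow> vectorspace K N \<Longrightarrow> tensor_pair K M N"
  by (simp add: vectorspace_def tensor_pair_def)

lemma linear_mapI:
  "\<lbrakk>vectorspace K M; vectorspace K N; f \<in> module_hom K M N\<rbrakk> \<Longrightarrow> linear_map K M N f"
  by (simp add: linear_map_def mod_hom_def mod_hom_axioms_def vectorspace_def)

lemma linear_mapD:
  assumes "linear_map K M N f"
  shows "vectorspace K M" "vectorspace K N" "f \<in> module_hom K M N"
  using assms by (simp_all add: linear_map_def mod_hom_def mod_hom_axioms_def)

lemma vectorspace_module: "vectorspace K M \<Longrightarrow> module K M"
  by (simp add: vectorspace_def)

lemma tensor_map:
  assumes f: "linear_map K M P f" and g: "linear_map K N Q g"
  shows tensor_map_linear: "linear_map K (tensor_space K M N) (tensor_space K P Q) (tensor_map K P Q f g)"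
    and tensor_map_tensor: "\<lbrakk>x \<in> carrier M; y \<in> carrier N\<rbrakk> \<Longrightarrow>
      tensor_map K P Q f g (tensor K M N x y) = tensor K P Q (f x) (g y)"
proof -
  note f' = linear_mapD[OF f] and g' = linear_mapD[OF g]
  note MN = tensor_pairI[OF f'(1) g'(1)]
  note PQ = tensor_pairI[OF f'(2) g'(2)]
  note m = tensor_pair.tensor_space_is_module[OF PQ]
  have b: "bilinear_map K M N (tensor_space K P Q) (\<lambda>x y. tensor K P Q (f x) (g y))"
    by (rule bilinear_map_comp[OF tensor_pair.tensor_bilinear[OF PQ] f'(3) g'(3)])
  show "linear_map K (tensor_space K M N) (tensor_space K P Q) (tensor_map K P Q f g)"
    unfolding tensor_map_def
    by (intro linear_mapI tensor_space_vectorspace f' g' tensor_pair.tensor_lift_hom[OF MN m b])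
  show "\<lbrakk>x \<in> carrier M; y \<in> carrier N\<rbrakk> \<Longrightarrow>
      tensor_map K P Q f g (tensor K M N x y) = tensor K P Q (f x) (g y)"
    unfolding tensor_map_def by (rule tensor_pair.tensor_lift_tensor[OF MN m b])
qed

lemma tensor_assoc:
  assumes "vectorspace K M" "vectorspace K N" "vectorspace K P"
  shows tensor_assoc_linear: "linear_map K (tensor_space K (tensor_space K M N) P)
      (tensor_space K M (tensor_space K N P)) (tensor_assoc K M N P)"
    and tensor_assoc_tensor: "\<lbrakk>x \<in> carrier M; y \<in> carrier N; z \<in> carrier P\<rbrakk> \<Longrightarrow>
      tensor_assoc K M N P (tensor K (tensor_space K M N) P (tensor K M N x y) z) =
      tensor K M (tensor_space K N P) x (tensor K N P y z)"
proof -
  let ?MN = "tensor_space K M N" and ?NP = "tensor_space K N P"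
  let ?L = "tensor_space K ?MN P" and ?R = "tensor_space K M ?NP"
  note VMN = tensor_space_vectorspace[OF assms(1,2)] and VNP = tensor_space_vectorspace[OF assms(2,3)]
  note VL = tensor_space_vectorspace[OF VMN assms(3)] and VR = tensor_space_vectorspace[OF assms(1) VNP]
  note MN = tensor_pairI[OF assms(1,2)] and NP = tensor_pairI[OF assms(2,3)]
  note L = tensor_pairI[OF VMN assms(3)] and R = tensor_pairI[OF assms(1) VNP]
  interpret VR: module K ?R by (rule vectorspace_module[OF VR])
  interpret VP: module K P by (rule vectorspace_module[OF assms(3)])
  note RB = tensor_pair.tensor_bilinear[OF R, unfolded bilinear_map_def, THEN conjunct1, rule_format]
    tensor_pair.tensor_bilinear[OF R, unfolded bilinear_map_def, THEN conjunct2, rule_format]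
  note NB = tensor_pair.tensor_bilinear[OF NP, unfolded bilinear_map_def, THEN conjunct1, rule_format]
    tensor_pair.tensor_bilinear[OF NP, unfolded bilinear_map_def, THEN conjunct2, rule_format]
  let ?\<phi> = "\<lambda>z x y. tensor K M ?NP x (tensor K N P y z)"
  let ?l = "\<lambda>z. tensor_lift K ?R (?\<phi> z)"
  have nc: "tensor K N P y z \<in> carrier ?NP" if "y \<in> carrier N" "z \<in> carrier P" for y z
    using NB(1)[OF that(1)] that(2) by (auto simp: module_hom_def)
  have bz: "bilinear_map K M N ?R (?\<phi> z)" if z: "z \<in> carrier P" for z
    unfolding bilinear_map_def
    using module_hom_comp[OF NB(2)[OF z] RB(1)] RB(2)[OF nc[OF _ z]] by blast
  note lh = tensor_pair.tensor_lift_hom[OF MN VR.module_axioms bz]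
  note lt = tensor_pair.tensor_lift_tensor[OF MN VR.module_axioms bz]
  have lc: "?l z t \<in> carrier ?R" if "z \<in> carrier P" "t \<in> carrier ?MN" for z t
    using lh[OF that(1)] that(2) by (auto simp: module_hom_def)
  have "(\<lambda>z. ?l z t) \<in> module_hom K P ?R" if t: "t \<in> carrier ?MN" for t
  proof -
    have rc: "tensor K M ?NP x w \<in> carrier ?R" if "x \<in> carrier M" "w \<in> carrier ?NP" for x w
      using RB(1)[OF that(1)] that(2) by (auto simp: module_hom_def)
    have ra: "tensor K M ?NP x (w \<oplus>\<^bsub>?NP\<^esub> w') = tensor K M ?NP x w \<oplus>\<^bsub>?R\<^esub> tensor K M ?NP x w'"
      if "x \<in> carrier M" "w \<in> carrier ?NP" "w' \<in> carrier ?NP" for x w w'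
      using RB(1)[OF that(1)] that(2-) by (auto simp: module_hom_def)
    have rs: "tensor K M ?NP x (c \<odot>\<^bsub>?NP\<^esub> w) = c \<odot>\<^bsub>?R\<^esub> tensor K M ?NP x w"
      if "x \<in> carrier M" "c \<in> carrier K" "w \<in> carrier ?NP" for x w c
      using RB(1)[OF that(1)] that(2-) by (auto simp: module_hom_def)
    have na: "tensor K N P y (z \<oplus>\<^bsub>P\<^esub> z') = tensor K N P y z \<oplus>\<^bsub>?NP\<^esub> tensor K N P y z'"
      if "y \<in> carrier N" "z \<in> carrier P" "z' \<in> carrier P" for y z z'
      using NB(1)[OF that(1)] that(2-) by (auto simp: module_hom_def)
    have ns: "tensor K N P y (c \<odot>\<^bsub>P\<^esub> z) = c \<odot>\<^bsub>?NP\<^esub> tensor K N P y z"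
      if "y \<in> carrier N" "c \<in> carrier K" "z \<in> carrier P" for y z c
      using NB(1)[OF that(1)] that(2-) by (auto simp: module_hom_def)
    have addh: "(\<lambda>t. f t \<oplus>\<^bsub>?R\<^esub> g t) \<in> module_hom K ?MN ?R"
      if "f \<in> module_hom K ?MN ?R" "g \<in> module_hom K ?MN ?R" for f g
      using that by (auto simp: module_hom_def Pi_iff VR.M.a_ac VR.smult_r_distr)
    have smulth: "(\<lambda>t. c \<odot>\<^bsub>?R\<^esub> f t) \<in> module_hom K ?MN ?R"
      if "f \<in> module_hom K ?MN ?R" "c \<in> carrier K" for f c
      using that by (auto simp: module_hom_def Pi_iff VR.smult_r_distr VR.R.m_comm simp flip: VR.smult_assoc1)
    have 1: "?l (z \<oplus>\<^bsub>P\<^esub> z') t = ?l z t \<oplus>\<^bsub>?R\<^esub> ?l z' t" if "z \<in> carrier P" "z' \<in> carrier P" for z z'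
      by (rule tensor_pair.tensor_hom_unique[OF MN VR.module_axioms _ _ _ t])
         (use that in \<open>auto intro!: lh addh simp: lt ra na nc VP.M.a_closed\<close>)
    have 2: "?l (c \<odot>\<^bsub>P\<^esub> z) t = c \<odot>\<^bsub>?R\<^esub> ?l z t" if "c \<in> carrier K" "z \<in> carrier P" for c z
      by (rule tensor_pair.tensor_hom_unique[OF MN VR.module_axioms _ _ _ t])
         (use that in \<open>auto intro!: lh smulth simp: lt rs ns nc VP.smult_closed\<close>)
    show ?thesis using 1 2 lc[OF _ t] by (auto simp: module_hom_def)
  qed
  then have b: "bilinear_map K ?MN P ?R (\<lambda>t z. ?l z t)"
    using lh by (auto simp: bilinear_map_def)
  show "linear_map K ?L ?R (tensor_assoc K M N P)"
    unfolding tensor_assoc_def Let_def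
    by (intro linear_mapI VL VR tensor_pair.tensor_lift_hom[OF L VR.module_axioms b])
  show "tensor_assoc K M N P (tensor K ?MN P (tensor K M N x y) z) =
      tensor K M ?NP x (tensor K N P y z)"
    if "x \<in> carrier M" "y \<in> carrier N" "z \<in> carrier P"
  proof -
    have "tensor K M N x y \<in> carrier ?MN"
      using tensor_pair.tensor_bilinear[OF MN] that by (auto simp: bilinear_map_def module_hom_def)
    then show ?thesis unfolding tensor_assoc_def Let_def
      by (simp add: tensor_pair.tensor_lift_tensor[OF L VR.module_axioms b] that lt)
  qed
qed

end

theory Submission
  imports Defs
begin

text \<open>Expanding \<open>T \<circ> (\<alpha> \<otimes> \<mu>) \<circ> (id \<otimes> T)\<close> on \<open>a \<otimes> b \<otimes> c\<close> and absorbing the outer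
  \<open>S\<close> by the Rota-Baxter identity for \<open>S\<close> leaves three terms, which are the image under
  \<open>\<alpha> \<otimes> \<mu>\<close> of
  \<open>\<tau> (a \<otimes> b \<otimes> c) = R a \<otimes> R b \<otimes> c + R a \<otimes> b \<otimes> S c + a \<otimes> S b \<otimes> S c\<close>.
  This \<open>\<tau>\<close> is a weak companion: likewise, the identity for \<open>R\<close> turns
  \<open>T \<circ> (\<mu> \<otimes> \<alpha>) \<circ> (T \<otimes> id)\<close> into \<open>(\<mu> \<otimes> \<alpha>) \<circ> \<tau>\<close>.\<close>

lemma linear_map_closed: "linear_map K M N f \<Longrightarrow> x \<in> carrier M \<Longrightarrow> f x \<in> carrier N"
  by (rule funcset_mem[OF module_hom_closed[OF linear_mapD(3)]])

lemma linear_map_add: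
  "\<lbrakk>linear_map K M N f; x \<in> carrier M; y \<in> carrier M\<rbrakk> \<Longrightarrow> f (x \<oplus>\<^bsub>M\<^esub> y) = f x \<oplus>\<^bsub>N\<^esub> f y"
  by (rule module_hom_add[OF linear_mapD(3)])

lemma linear_map_id: "vectorspace K M \<Longrightarrow> linear_map K M M id"
  by (rule linear_mapI) (auto simp: module_hom_def)

lemma linear_map_comp:
  "linear_map K M N f \<Longrightarrow> linear_map K N P g \<Longrightarrow> linear_map K M P (\<lambda>x. g (f x))"
  by (rule linear_mapI[OF linear_mapD(1) linear_mapD(2) module_hom_comp[OF linear_mapD(3) linear_mapD(3)]])

lemma linear_map_sum:
  assumes f: "linear_map K M N f" and g: "linear_map K M N g"
  shows "linear_map K M N (\<lambda>x. f x \<oplus>\<^bsub>N\<^esub> g x)"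
proof (rule linear_mapI)
  show "vectorspace K M" "vectorspace K N" using linear_mapD[OF f] by blast+
  then interpret N: vectorspace K N by simp
  show "(\<lambda>x. f x \<oplus>\<^bsub>N\<^esub> g x) \<in> module_hom K M N"
    using linear_mapD(3)[OF f] linear_mapD(3)[OF g]
    by (auto simp: module_hom_def Pi_iff N.M.a_ac N.smult_r_distr)
qed

lemma vectorspace_add_closed:
  assumes "vectorspace K M" "x \<in> carrier M" "y \<in> carrier M"
  shows "x \<oplus>\<^bsub>M\<^esub> y \<in> carrier M"
proof -
  interpret vectorspace K M by fact
  show ?thesis using assms(2,3) by (rule M.a_closed)
qed

lemma tensor_closed:
  assumes "vectorspace K M" "vectorspace K N" "x \<in> carrier M" "y \<in> carrier N"
  shows "tensor K M N x y \<in> carrier (tensor_space K M N)"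
  using tensor_pair.tensor_bilinear[OF tensor_pairI[OF assms(1,2)]] assms(3,4)
  by (auto simp: bilinear_map_def module_hom_def)

lemma tensor_add_left:
  assumes "vectorspace K M" "vectorspace K N"
    "x \<in> carrier M" "x' \<in> carrier M" "y \<in> carrier N"
  shows "tensor K M N (x \<oplus>\<^bsub>M\<^esub> x') y = tensor K M N x y \<oplus>\<^bsub>tensor_space K M N\<^esub> tensor K M N x' y"
  using tensor_pair.tensor_bilinear[OF tensor_pairI[OF assms(1,2)]] assms(3-)
  by (auto simp: bilinear_map_def module_hom_def)

lemma tensor_add_right:
  assumes "vectorspace K M" "vectorspace K N"
    "x \<in> carrier M" "y \<in> carrier N" "y' \<in> carrier N"
  shows "tensor K M N x (y \<oplus>\<^bsub>N\<^esub> y') = tensor K M N x y \<oplus>\<^bsub>tensor_space K M N\<^esub> tensor K M N x y'"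
  using tensor_pair.tensor_bilinear[OF tensor_pairI[OF assms(1,2)]] assms(3-)
  by (auto simp: bilinear_map_def module_hom_def)

lemma linear_map_tensor_eqI:
  assumes "vectorspace K M" "vectorspace K N"
    and f: "linear_map K (tensor_space K M N) P f" and g: "linear_map K (tensor_space K M N) P g"
    and "\<And>x y. x \<in> carrier M \<Longrightarrow> y \<in> carrier N \<Longrightarrow> f (tensor K M N x y) = g (tensor K M N x y)"
    and "t \<in> carrier (tensor_space K M N)"
  shows "f t = g t"
  using tensor_pair.tensor_hom_unique[OF tensor_pairI[OF assms(1,2)]
      vectorspace_module[OF linear_mapD(2)[OF f]] linear_mapD(3)[OF f] linear_mapD(3)[OF g]] assms(5,6)
  by blast

lemma linear_map_tensor_fixed_right:
  assumes "vectorspace K M" "vectorspace K N" "y \<in> carrier N"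
  shows "linear_map K M (tensor_space K M N) (\<lambda>x. tensor K M N x y)"
  using tensor_pair.tensor_bilinear[OF tensor_pairI[OF assms(1,2)]] assms
  by (intro linear_mapI tensor_space_vectorspace) (auto simp: bilinear_map_def)

text \<open>Uniqueness is applied twice. The outer use reduces the claim to \<open>t\<close> tensor
  \<open>z\<close> with \<open>t\<close> arbitrary in \<open>LM\<close>. For fixed \<open>z\<close>,
  composing with \<open>linear_map_tensor_fixed_right\<close> gives two linear maps in
  \<open>t\<close>, so pure tensors suffice there too.\<close>

lemma linear_map_tensor3_eqI:
  assumes V: "vectorspace K L" "vectorspace K M" "vectorspace K N"
  defines "LM \<equiv> tensor_space K L M"
  assumes f: "linear_map K (tensor_space K LM N) P f"
    and g: "linear_map K (tensor_space K LM N) P g"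
    and eq: "\<And>x y z. x \<in> carrier L \<Longrightarrow> y \<in> carrier M \<Longrightarrow> z \<in> carrier N \<Longrightarrow>
      f (tensor K LM N (tensor K L M x y) z) = g (tensor K LM N (tensor K L M x y) z)"
    and w: "w \<in> carrier (tensor_space K LM N)"
  shows "f w = g w"
proof (rule linear_map_tensor_eqI[OF _ V(3) f g _ w])
  show LM: "vectorspace K LM" unfolding LM_def by (rule tensor_space_vectorspace[OF V(1,2)])
  fix t z assume t: "t \<in> carrier LM" and z: "z \<in> carrier N"
  note i = linear_map_tensor_fixed_right[OF LM V(3) z]
  show "f (tensor K LM N t z) = g (tensor K LM N t z)"
    by (rule linear_map_tensor_eqI[OF V(1,2) linear_map_comp[OF i f, unfolded LM_def]
        linear_map_comp[OF i g, unfolded LM_def] _ t[unfolded LM_def], folded LM_def])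
      (rule eq[OF _ _ z])
qed

context rota_baxter_system
begin

abbreviation "A2 \<equiv> tensor_space K A A"
abbreviation "A3 \<equiv> tensor_space K A2 A"
abbreviation tensor2 (infixl \<open>\<otimes>\<^sub>2\<close> 70) where "x \<otimes>\<^sub>2 y \<equiv> tensor K A A x y"
abbreviation tensor3 (infixl \<open>\<otimes>\<^sub>3\<close> 70) where "t \<otimes>\<^sub>3 z \<equiv> tensor K A2 A t z"

text \<open>The witness for existence. Being assembled from tensor maps, it inherits linearity from
  \<open>tensor_map_linear\<close>.\<close>

definition rota_baxter_twist where
  "rota_baxter_twist t = tensor_map K A A R id t \<oplus>\<^bsub>A2\<^esub> tensor_map K A A id S t"

text \<open>The pattern extends that of the twist: one factor stays bare, \<open>R\<close> acts on
  every factor to its left and \<open>S\<close> on every factor to its right.\<close>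

definition rota_baxter_companion where
  "rota_baxter_companion w = tensor_map K A2 A (tensor_map K A A R R) id w
    \<oplus>\<^bsub>A3\<^esub> (tensor_map K A2 A (tensor_map K A A R id) S w
    \<oplus>\<^bsub>A3\<^esub> tensor_map K A2 A (tensor_map K A A id S) S w)"

lemma V: "vectorspace K A" and V2: "vectorspace K A2" and V3: "vectorspace K A3"
  and V3': "vectorspace K (tensor_space K A A2)"
  by (intro tensor_space_vectorspace vectorspace_axioms)+

lemmas lin = alpha_linear R_linear S_linear mu_linear linear_map_id[OF V] linear_map_id[OF V2]
lemmas closed = lin[THEN linear_map_closed]
lemmas tensor_closed_A = tensor_closed[OF V V] tensor_closed[OF V2 V] tensor_closed[OF V V2]

lemma rota_baxter_twist_linear: "linear_map K A2 A2 rota_baxter_twist"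
  unfolding rota_baxter_twist_def[abs_def] by (intro linear_map_sum tensor_map_linear lin)

lemma rota_baxter_twist_tensor:
  "a \<in> carrier A \<Longrightarrow> b \<in> carrier A \<Longrightarrow>
    rota_baxter_twist (a \<otimes>\<^sub>2 b) = R a \<otimes>\<^sub>2 b \<oplus>\<^bsub>A2\<^esub> a \<otimes>\<^sub>2 S b"
  by (simp add: rota_baxter_twist_def tensor_map_tensor[OF R_linear linear_map_id[OF V]]
      tensor_map_tensor[OF linear_map_id[OF V] S_linear])

lemma rota_baxter_companion_linear: "linear_map K A3 A3 rota_baxter_companion"
  unfolding rota_baxter_companion_def[abs_def] by (intro linear_map_sum tensor_map_linear lin)

lemma rota_baxter_companion_tensor:
  assumes "a \<in> carrier A" "b \<in> carrier A" "c \<in> carrier A"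
  shows "rota_baxter_companion (a \<otimes>\<^sub>2 b \<otimes>\<^sub>3 c) =
    R a \<otimes>\<^sub>2 R b \<otimes>\<^sub>3 c \<oplus>\<^bsub>A3\<^esub> (R a \<otimes>\<^sub>2 b \<otimes>\<^sub>3 S c \<oplus>\<^bsub>A3\<^esub> a \<otimes>\<^sub>2 S b \<otimes>\<^sub>3 S c)"
proof -
  \<comment> \<open>An outer tensor map can be evaluated only once its inner factor is known to be
    linear.\<close>
  note t = lin tensor_map_linear[OF R_linear R_linear]
    tensor_map_linear[OF R_linear linear_map_id[OF V]]
    tensor_map_linear[OF linear_map_id[OF V] S_linear]
  show ?thesis unfolding rota_baxter_companion_def
    using assms by (simp add: t[THEN tensor_map_tensor] t tensor_map_tensor tensor_closed_A V)
qed

text \<open>Stated for any \<open>T\<close> with the prescribed values, since such a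
  \<open>T\<close> is determined only on the carrier and may differ from
  \<open>rota_baxter_twist\<close> outside it.\<close>

lemma is_weak_pseudotwistor:
  assumes T: "linear_map K A2 A2 T"
    and Tt: "\<And>a b. a \<in> carrier A \<Longrightarrow> b \<in> carrier A \<Longrightarrow>
      T (a \<otimes>\<^sub>2 b) = R a \<otimes>\<^sub>2 b \<oplus>\<^bsub>A2\<^esub> a \<otimes>\<^sub>2 S b"
  shows "weak_pseudotwistor K A \<alpha> \<mu> T"
proof -
  interpret M2: vectorspace K A2 by (rule V2)
  let ?\<alpha>2 = "tensor_map K A A \<alpha> \<alpha>"
  let ?\<alpha>3 = "tensor_map K A2 A ?\<alpha>2 \<alpha>"
  let ?assoc = "tensor_assoc K A A A"
  let ?\<alpha>\<mu> = "tensor_map K A A \<alpha> \<mu>"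
  let ?\<mu>\<alpha> = "tensor_map K A A \<mu> \<alpha>"
  let ?\<tau> = rota_baxter_companion
  let ?idT = "tensor_map K A A2 id T"
  let ?Tid = "tensor_map K A2 A T id"
  note id = linear_map_id[OF V]
  note a2 = tensor_map[OF alpha_linear alpha_linear]
  note a3 = tensor_map[OF a2(1) alpha_linear]
  note as = tensor_assoc[OF V V V]
  note am = tensor_map[OF alpha_linear mu_linear]
  note ma = tensor_map[OF mu_linear alpha_linear]
  note iT = tensor_map[OF id T]
  note Ti = tensor_map[OF T id]
  note \<tau> = rota_baxter_companion_linear
  note add = a2(1) a3(1) as(1) am(1) ma(1) iT(1) Ti(1) T mu_linear
  note add = add[THEN linear_map_add]
  \<comment> \<open>\<open>?Tid\<close> creates sums in the left factor of \<open>A3\<close>,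
    \<open>?idT\<close> in the right factor of the other bracketing; \<mu> and \<open>rb\<close>
    then move sums into the factors of \<open>A2\<close>.\<close>
  note tensor_add = tensor_add_left[OF V2 V] tensor_add_right[OF V V2]
    tensor_add_left[OF V V] tensor_add_right[OF V V]
  note sum_closed = V2[THEN vectorspace_add_closed] V3[THEN vectorspace_add_closed]
    V3'[THEN vectorspace_add_closed]
  note vals = a2(2) a3(2) as(2) am(2) ma(2) iT(2) Ti(2) Tt rota_baxter_companion_tensor
  note simps = vals add tensor_add sum_closed tensor_closed_A closed
  \<comment> \<open>The outer maps are distributed over the sum because the simplifier expands every
    argument into a sum of pure tensors first.\<close>
  have rb: "\<mu> (R a \<otimes>\<^sub>2 R b) = R (\<mu> (R a \<otimes>\<^sub>2 b)) \<oplus>\<^bsub>A\<^esub> R (\<mu> (a \<otimes>\<^sub>2 S b))"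
    "\<mu> (S a \<otimes>\<^sub>2 S b) = S (\<mu> (R a \<otimes>\<^sub>2 b)) \<oplus>\<^bsub>A\<^esub> S (\<mu> (a \<otimes>\<^sub>2 S b))"
    if "a \<in> carrier A" "b \<in> carrier A" for a b
    using that rota_baxter_R rota_baxter_S
    by (simp_all add: linear_map_add[OF R_linear] linear_map_add[OF S_linear] closed tensor_closed_A)
  have "?\<alpha>2 (T t) = T (?\<alpha>2 t)" if "t \<in> carrier A2" for t
    by (rule linear_map_tensor_eqI[OF V V linear_map_comp[OF T a2(1)] linear_map_comp[OF a2(1) T] _ that])
      (simp add: simps alpha_R alpha_S)
  moreover have "?\<alpha>3 (?\<tau> w) = ?\<tau> (?\<alpha>3 w)" if "w \<in> carrier A3" for w
    by (rule linear_map_tensor3_eqI[OF V V V linear_map_comp[OF \<tau> a3(1)] linear_map_comp[OF a3(1) \<tau>] _ that])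
      (simp add: simps alpha_R alpha_S)
  \<comment> \<open>The left side yields four terms. Two have \<open>R (\<alpha> a)\<close> in front
    and match two companion terms via \<open>alpha_R\<close>; the other two are what
    \<open>rb\<close> makes of \<open>\<mu> (S b \<otimes>\<^sub>2 S c)\<close>.\<close>
  moreover have "T (?\<alpha>\<mu> (?idT (?assoc w))) = ?\<alpha>\<mu> (?assoc (?\<tau> w))" if "w \<in> carrier A3" for w
    by (rule linear_map_tensor3_eqI[OF V V V
          linear_map_comp[OF linear_map_comp[OF linear_map_comp[OF as(1) iT(1)] am(1)] T]
          linear_map_comp[OF linear_map_comp[OF \<tau> as(1)] am(1)] _ that])
      (simp add: simps rb alpha_R alpha_S M2.M.a_ac)
  \<comment> \<open>The mirror image: \<open>rb\<close> splits
    \<open>\<mu> (R a \<otimes>\<^sub>2 R b)\<close>, and \<open>alpha_S\<close> matches the two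
    terms ending in \<open>S (\<alpha> c)\<close>.\<close>
  moreover have "T (?\<mu>\<alpha> (?Tid w)) = ?\<mu>\<alpha> (?\<tau> w)" if "w \<in> carrier A3" for w
    by (rule linear_map_tensor3_eqI[OF V V V
          linear_map_comp[OF linear_map_comp[OF Ti(1) ma(1)] T]
          linear_map_comp[OF \<tau> ma(1)] _ that])
      (simp add: simps rb alpha_R alpha_S M2.M.a_ac)
  ultimately show ?thesis
    using T \<tau> unfolding weak_pseudotwistor_def weak_companion_def Let_def by blast
qed

end

theorem proposition3p8:
  fixes K :: "('k, 'r) ring_scheme" and A :: "('k, 'a, 'm) module_scheme"
    and \<alpha> R S :: "'a \<Rightarrow> 'a" and \<mu> :: "('a \<times> 'a \<Rightarrow> 'k) set \<Rightarrow> 'a"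
  defines "A2 \<equiv> tensor_space K A A"
  defines "is_T \<equiv> (\<lambda>T. linear_map K A2 A2 T \<and>
    (\<forall>a\<in>carrier A. \<forall>b\<in>carrier A.
       T (tensor K A A a b) = tensor K A A (R a) b \<oplus>\<^bsub>A2\<^esub> tensor K A A a (S b)))"
  assumes "rota_baxter_system K A \<alpha> \<mu> R S"
  shows "(\<exists>T. is_T T) \<and> (\<forall>T. is_T T \<longrightarrow> weak_pseudotwistor K A \<alpha> \<mu> T)"
proof -
  interpret rota_baxter_system K A \<alpha> \<mu> R S by fact
  show ?thesis
    unfolding is_T_def A2_def
    using rota_baxter_twist_linear rota_baxter_twist_tensor is_weak_pseudotwistor by blast
qed

end
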